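(* Fix integers $p\ge2$ and $n\ge3$. (a) Every nonempty compact $\mathrm{SU}(n)$-invariant subset $\mathbb{G}\subset G^{\mathbb{R}}(p,\mathbb{C}^n)$, except the set $G^{\mathbb{C}}(1,\mathbb{C}^n)\subset G^{\mathbb{R}}(2,\mathbb{C}^n)$ of complex lines, has the transitivity property. (b) Every nonempty compact $\mathrm{Sp}(n)\cdot\mathrm{Sp}(1)$-invariant subset $\mathbb{G}\subset G^{\mathbb{R}}(p,\mathbb{H}^n)$ has the transitivity property, with three exceptions: the sets of real $p$-planes which lie in a quaternion line, for $p=2,3,4$. (c) For $p\ge5$, every nonempty compact $\mathrm{Sp}(n)$-invariant subset $\mathbb{G}\subset G^{\mathbb{R}}(p,\mathbb{H}^n)$ has the transitivity property.
   Context: $G^{\mathbb{R}}(p,V)$ is the Grassmannian of real $p$-dimensional subspaces of the real vector space underlying $V=\mathbb{C}^n$ or $\mathbb{H}^n$. $\mathrm{Sp}(n)$ acts on $\mathbb{H}^n$ by quaternion-linear isometries, $\mathrm{Sp}(1)$ by unit quaternion scalar multiplication. A set $\mathbb{G}$ of real $p$-planes in $\mathbb{R}^N$ has the transitivity property if for any two vectors $x,y\in\mathbb{R}^N$ there exist $W_1,\dots,W_k\in\mathbb{G}$ with $x\in W_1$, $y\in W_k$ and $\dim_{\mathbb{R}}(W_i\cap W_{i+1})>0$ for $i=1,\dots,k-1$. *)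

theory Defs
  imports "HOL-Analysis.Analysis"
begin

definition Grass :: "nat \<Rightarrow> 'a::euclidean_space set set" where
  "Grass p = {W. subspace W \<and> dim W = p}"

definition oproj :: "'a::euclidean_space set \<Rightarrow> 'a \<Rightarrow> 'a" where
  "oproj W x = (THE y. y \<in> W \<and> (\<forall>w\<in>W. inner (x - y) w = 0))"

text \<open>Topology of the Grassmannian: a subspace is identified with its orthogonal
projection, viewed in the normed space of bounded linear operators.\<close>
definition grass_compact :: "'a::euclidean_space set set \<Rightarrow> bool" where
  "grass_compact G \<longleftrightarrow> compact ((\<lambda>W. Blinfun (oproj W)) ` G)"

definition transitivity_property :: "'a::euclidean_space set set \<Rightarrow> bool" where
  "transitivity_property G \<longleftrightarrow>
     (\<forall>x y. \<exists>k (W :: nat \<Rightarrow> 'a set). k \<ge> 1 \<and> (\<forall>i<k. W i \<in> G) \<and>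
        x \<in> W 0 \<and> y \<in> W (k - 1) \<and>
        (\<forall>i. Suc i < k \<longrightarrow> dim (W i \<inter> W (Suc i)) > 0))"

definition cnj_transpose :: "complex^'n^'n \<Rightarrow> complex^'n^'n" where
  "cnj_transpose U = (\<chi> i j. cnj (U $ j $ i))"

definition SU :: "(complex^'n^'n) set" where
  "SU = {U. U ** cnj_transpose U = mat 1 \<and> det U = 1}"

definition SU_invariant :: "(complex^'n) set set \<Rightarrow> bool" where
  "SU_invariant G \<longleftrightarrow> (\<forall>U\<in>SU. \<forall>W\<in>G. (\<lambda>v. U *v v) ` W \<in> G)"

definition complex_lines :: "(complex^'n) set set" where
  "complex_lines = {range (\<lambda>c::complex. c *s v) | v. v \<noteq> 0}"

text \<open>Quaternions are modelled as real^4 with components 1, i, j, k in positions 1..4;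
Hamilton product:\<close>
definition hmult :: "real^4 \<Rightarrow> real^4 \<Rightarrow> real^4" where
  "hmult p q = vector
     [p$1*q$1 - p$2*q$2 - p$3*q$3 - p$4*q$4,
      p$1*q$2 + p$2*q$1 + p$3*q$4 - p$4*q$3,
      p$1*q$3 - p$2*q$4 + p$3*q$1 + p$4*q$2,
      p$1*q$4 + p$2*q$3 - p$3*q$2 + p$4*q$1]"

definition hsmult :: "(real^4)^'n \<Rightarrow> real^4 \<Rightarrow> (real^4)^'n" where
  "hsmult v q = (\<chi> i. hmult (v $ i) q)"

definition Sp :: "((real^4)^'n \<Rightarrow> (real^4)^'n) set" where
  "Sp = {A. linear A \<and> (\<forall>v. norm (A v) = norm v) \<and> (\<forall>v q. A (hsmult v q) = hsmult (A v) q)}"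

definition Sp_invariant :: "((real^4)^'n) set set \<Rightarrow> bool" where
  "Sp_invariant G \<longleftrightarrow> (\<forall>A\<in>Sp. \<forall>W\<in>G. A ` W \<in> G)"

definition SpSp1_invariant :: "((real^4)^'n) set set \<Rightarrow> bool" where
  "SpSp1_invariant G \<longleftrightarrow>
     (\<forall>A\<in>Sp. \<forall>q::real^4. norm q = 1 \<longrightarrow> (\<forall>W\<in>G. (\<lambda>v. hsmult (A v) q) ` W \<in> G))"

definition in_quaternion_line :: "nat \<Rightarrow> ((real^4)^'n) set set" where
  "in_quaternion_line p = {W \<in> Grass p. \<exists>v. v \<noteq> 0 \<and> W \<subseteq> range (hsmult v)}"

end

theory Submission
  imports Defs
begin

text \<open>If some plane of the family is not contained in a complex (quaternion) line, it contains
  unit vectors \<open>u\<close>, \<open>v\<close> whose Hermitian product \<open>h\<close> has norm less than 1. The group acts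
  transitively on pairs of vectors with prescribed lengths and Hermitian product, so any two unit
  vectors with product \<open>h\<close> lie in a common plane of the family. If \<open>\<langle>x, y\<rangle> = c\<close> is real with
  \<open>2 \<bar>h\<bar>\<^sup>2 \<le> 1 + c\<close>, then \<open>x\<close> and \<open>y\<close> have a common neighbour
  \<open>z = (x + y) h / (1 + c) + s w\<close> with \<open>w\<close> orthogonal to \<open>x\<close> and \<open>y\<close>. Rotating in small steps
  connects any two orthogonal unit vectors, and then any two unit vectors via a third one
  orthogonal to both, which exists since \<open>n \<ge> 3\<close>. In the remaining case all planes lie in
  lines, and the group is transitive on such planes, which are the exceptions.\<close>

section \<open>Hermitian spaces over the complex numbers and the quaternions\<close>

text \<open>One set of axioms covers complex and quaternionic vectors, so the core argument is
  carried out once. Scalars act from the right, which stays compatible with linear maps acting from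
  the left when \<open>mul\<close> does not commute. All metric axioms use the real inner
  product.\<close>

locale herm_space =
  fixes mul :: "'k::euclidean_space \<Rightarrow> 'k \<Rightarrow> 'k" and one :: 'k and conj :: "'k \<Rightarrow> 'k"
    and sm :: "'v::euclidean_space \<Rightarrow> 'k \<Rightarrow> 'v"
  assumes bilinear_sm: "bilinear sm" and bilinear_mul: "bilinear mul"
    and sm_one: "sm v one = v"
    and sm_sm: "sm (sm v a) b = sm v (mul a b)"
    and mul_assoc: "mul (mul a b) c = mul a (mul b c)"
    and one_mul: "mul one a = a" and mul_one: "mul a one = a"
    and norm_one: "norm one = 1"
    and inner_sm_sm: "inner (sm x q) (sm x r) = inner x x * inner q r"
    and inner_sm: "inner (sm x q) y = inner x (sm y (conj q))"
    and inner_mul: "inner (mul a b) c = inner a (mul c (conj b))"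
    and mul_conj: "mul a (conj a) = inner a a *\<^sub>R one"
    and conj_mul: "mul (conj a) a = inner a a *\<^sub>R one"
    and inner_mul_mul: "inner (mul a b) (mul a b) = inner a a * inner b b"
begin

text \<open>The Hermitian product with values in \<open>'k\<close>, conjugate linear in the first argument:
  it is determined by \<open>inner r (hp x y) = inner (sm x r) y\<close>.\<close>
definition hp :: "'v \<Rightarrow> 'v \<Rightarrow> 'k" where
  "hp x = adjoint (sm x)"

definition unitary :: "('v \<Rightarrow> 'v) set" where
  "unitary = {A. linear A \<and> (\<forall>v. norm (A v) = norm v) \<and> (\<forall>v q. A (sm v q) = sm (A v) q)}"

lemmas linear_sm_right = bilinear_sm[unfolded bilinear_def, THEN conjunct1, rule_format]

lemmas sm_linear = bilinear_radd[OF bilinear_sm] bilinear_ladd[OF bilinear_sm]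
  bilinear_rsub[OF bilinear_sm] bilinear_lsub[OF bilinear_sm]
  bilinear_rmul[OF bilinear_sm] bilinear_lmul[OF bilinear_sm]
  bilinear_rneg[OF bilinear_sm] bilinear_lneg[OF bilinear_sm]
  bilinear_rzero[OF bilinear_sm] bilinear_lzero[OF bilinear_sm]

lemmas mul_linear = bilinear_radd[OF bilinear_mul] bilinear_ladd[OF bilinear_mul]
  bilinear_rsub[OF bilinear_mul] bilinear_lsub[OF bilinear_mul]
  bilinear_rmul[OF bilinear_mul] bilinear_lmul[OF bilinear_mul]
  bilinear_rneg[OF bilinear_mul] bilinear_lneg[OF bilinear_mul]
  bilinear_rzero[OF bilinear_mul] bilinear_lzero[OF bilinear_mul]

lemma inner_hp: "inner r (hp x y) = inner (sm x r) y"
  unfolding hp_def by (rule adjoint_works[OF linear_sm_right])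

lemma hp_eqI: "(\<And>r. inner r h = inner (sm x r) y) \<Longrightarrow> hp x y = h"
  using inner_hp vector_eq_ldot by metis

lemma hp_add_right: "hp x (y + z) = hp x y + hp x z"
  by (rule hp_eqI) (simp add: inner_add_right inner_hp)

lemma hp_add_left: "hp (x + y) z = hp x z + hp y z"
  by (rule hp_eqI) (simp add: inner_add_right inner_add_left inner_hp sm_linear)

lemma hp_diff_right: "hp x (y - z) = hp x y - hp x z"
  by (rule hp_eqI) (simp add: inner_diff_right inner_hp)

lemma hp_diff_left: "hp (x - y) z = hp x z - hp y z"
  by (rule hp_eqI) (simp add: inner_diff_right inner_diff_left inner_hp sm_linear)

lemma hp_scaleR_right: "hp x (c *\<^sub>R y) = c *\<^sub>R hp x y"
  by (rule hp_eqI) (simp add: inner_hp)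

lemma hp_scaleR_left: "hp (c *\<^sub>R x) y = c *\<^sub>R hp x y"
  by (rule hp_eqI) (simp add: inner_hp sm_linear)

lemmas hp_linear = hp_add_right hp_add_left hp_diff_right hp_diff_left
  hp_scaleR_right hp_scaleR_left

lemma hp_sm: "hp x (sm y q) = mul (hp x y) q"
proof (rule hp_eqI)
  fix r
  have "inner r (mul (hp x y) q) = inner (mul (hp x y) q) r"
    by (rule inner_commute)
  also have "\<dots> = inner (mul r (conj q)) (hp x y)"
    by (metis inner_mul inner_commute)
  also have "\<dots> = inner (sm (sm x r) (conj q)) y"
    by (simp add: inner_hp sm_sm)
  also have "\<dots> = inner (sm x r) (sm y q)"
    by (metis inner_commute inner_sm)
  finally show "inner r (mul (hp x y) q) = inner (sm x r) (sm y q)" .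
qed

lemma hp_self_sm: "hp x (sm x q) = inner x x *\<^sub>R q"
  by (rule hp_eqI) (simp add: inner_sm_sm)

lemma hp_self: "hp x x = inner x x *\<^sub>R one"
  using hp_self_sm[of x one] by (simp add: sm_one)

lemma inner_one_hp: "inner one (hp x y) = inner x y"
  by (simp add: inner_hp sm_one)

lemma inner_one_conj: "inner one (conj a) = inner one a"
  by (metis inner_mul one_mul inner_commute)

text \<open>A vanishing \<open>hp x y\<close> means that \<open>y\<close> is orthogonal to the whole
  line of \<open>x\<close>; moving scalars across the inner product turns this into orthogonality of
  \<open>x\<close> to the line of \<open>y\<close>.\<close>

lemma hp_zero_commute: "hp x y = 0 \<Longrightarrow> hp y x = 0"
  by (rule hp_eqI) (metis inner_sm inner_hp inner_commute inner_zero_right)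

lemma norm_sm: "norm (sm x q) = norm x * norm q"
  by (simp add: norm_eq_sqrt_inner inner_sm_sm real_sqrt_mult)

section \<open>Unitary maps and pairs of vectors\<close>

lemma unitary_hp:
  assumes "A \<in> unitary" shows "hp (A x) (A y) = hp x y"
proof (rule hp_eqI)
  fix r
  have "orthogonal_transformation A"
    using assms by (auto simp: unitary_def orthogonal_transformation)
  moreover have "sm (A x) r = A (sm x r)"
    using assms by (auto simp: unitary_def)
  ultimately show "inner r (hp x y) = inner (sm (A x) r) (A y)"
    by (simp add: orthogonal_transformation_def inner_hp)
qed

lemma unitary_comp: "A \<in> unitary \<Longrightarrow> B \<in> unitary \<Longrightarrow> A \<circ> B \<in> unitary"
  by (auto simp: unitary_def linear_compose)

text \<open>The complex (quaternionic) reflection that moves \<open>u\<close> to \<open>x\<close> and fixes the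
  Hermitian complement of \<open>d = x - u\<close>. It is isometric since the real part of
  \<open>\<langle>d, u\<rangle>\<close> is \<open>-\<bar>d\<bar>\<^sup>2 / 2\<close>.\<close>
lemma unitary_reflection:
  assumes "norm x = norm u"
  shows "\<exists>A\<in>unitary. A u = x \<and> (\<forall>z. hp (x - u) z = 0 \<longrightarrow> A z = z)"
proof (cases "x = u")
  case True
  have "id \<in> unitary" by (auto simp: unitary_def linear_id)
  then show ?thesis using True by (intro bexI[of _ id]) auto
next
  case False
  define d where "d = x - u"
  define k where "k = hp d u"
  have xu: "inner x x = inner u u" using assms by (simp add: norm_eq)
  have Rek: "inner one k = - inner d d / 2"
    unfolding k_def inner_one_hp d_def
    using xu by (simp add: inner_diff_left inner_diff_right inner_commute)
  have dd: "inner d d > 0" using False by (simp add: d_def)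
  then have "k \<noteq> 0" using Rek by auto
  then have kk: "inner k k > 0" by simp
  \<comment> \<open>The factor \<open>a\<close> is the negative inverse of \<open>k\<close>, so that
    \<open>A\<close> below sends u to u - d a k = u + d = x.\<close>
  define a where "a = (- 1 / inner k k) *\<^sub>R conj k"
  have ak: "mul a k = - one"
    using kk by (simp add: a_def mul_linear conj_mul)
  have "inner a a * inner k k = 1"
    using inner_mul_mul[of a k] norm_one by (simp add: ak norm_eq_1)
  then have aa: "inner a a = 1 / inner k k" using kk by (simp add: field_simps)
  \<comment> \<open>This identity makes \<open>A\<close> isometric: the vector \<open>?w\<close>
    subtracted from \<open>z\<close> then satisfies |?w|^2 = 2 (z, ?w).\<close>
  have Rea: "2 * inner a one = inner d d * inner a a"
    unfolding aa using kk Rek inner_one_conj[of k]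
    by (simp add: a_def inner_commute field_simps)
  define A where "A z = z - sm d (mul a (hp d z))" for z
  have lin: "linear A"
    by (rule linearI) (simp_all add: A_def hp_linear sm_linear mul_linear algebra_simps)
  have "norm (A z) = norm z" for z
  proof -
    let ?k = "hp d z"
    let ?w = "sm d (mul a ?k)"
    have 1: "inner z ?w = inner a one * inner ?k ?k"
    proof -
      have "inner z ?w = inner (mul a ?k) ?k" by (metis inner_hp inner_commute)
      also have "\<dots> = inner a one * inner ?k ?k" by (simp add: inner_mul mul_conj)
      finally show ?thesis .
    qed
    have "inner ?w ?w = inner d d * (inner a a * inner ?k ?k)"
      by (simp add: inner_sm_sm inner_mul_mul)
    also have "\<dots> = 2 * inner z ?w" unfolding 1 using Rea by simp
    finally have "inner (A z) (A z) = inner z z"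
      unfolding A_def by (simp add: inner_diff_left inner_diff_right inner_commute)
    then show ?thesis by (simp add: norm_eq)
  qed
  moreover have "A (sm z q) = sm (A z) q" for z q
    by (simp add: A_def hp_sm sm_linear sm_sm mul_assoc)
  ultimately have "A \<in> unitary" using lin by (simp add: unitary_def)
  moreover have "A u = x"
    using ak by (simp add: A_def k_def[symmetric] sm_linear sm_one) (simp add: d_def)
  moreover have "\<forall>z. hp (x - u) z = 0 \<longrightarrow> A z = z"
    by (simp add: A_def d_def mul_linear sm_linear)
  ultimately show ?thesis by blast
qed

text \<open>A first reflection takes \<open>u\<close> to \<open>x\<close>. The remaining error y - A
  v is orthogonal to \<open>x\<close>, because <x, A v> = <u, v> = <x, y>, so the reflection taking
  A v to \<open>y\<close> fixes \<open>x\<close>.\<close>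

lemma unitary_pair_transitive:
  assumes "norm x = norm u" "norm y = norm v" "hp x y = hp u v"
  shows "\<exists>A\<in>unitary. A u = x \<and> A v = y"
proof -
  obtain A where A: "A \<in> unitary" "A u = x" using unitary_reflection[OF assms(1)] by blast
  have "norm y = norm (A v)" using A assms(2) by (auto simp: unitary_def)
  from unitary_reflection[OF this] obtain B where
    B: "B \<in> unitary" "B (A v) = y" "\<forall>z. hp (y - A v) z = 0 \<longrightarrow> B z = z" by blast
  have "hp x (y - A v) = 0"
    using unitary_hp[OF A(1), of u v] assms(3) A(2) by (simp add: hp_linear)
  then have "B x = x" using B(3) hp_zero_commute by blast
  then show ?thesis using A B unitary_comp[OF B(1) A(1)] by (intro bexI[of _ "B \<circ> A"]) auto
qed

section \<open>Orthogonal vectors and the Cauchy-Schwarz inequality\<close>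

lemma dim_range_sm: "dim (range (sm u)) \<le> DIM('k)"
  using dim_image_le[OF linear_sm_right, of u UNIV] by simp

lemma subspace_range_sm: "subspace (range (sm u))"
  using linear_subspace_image[OF linear_sm_right subspace_UNIV] .

text \<open>Two lines span at most two thirds of the real dimension, and real orthogonality to a
  whole line is Hermitian orthogonality.\<close>

lemma exists_unit_orthogonal:
  assumes "DIM('v) \<ge> 3 * DIM('k)"
  shows "\<exists>w. norm w = 1 \<and> hp w x = 0 \<and> hp w y = 0 \<and> hp x w = 0 \<and> hp y w = 0"
proof -
  let ?S = "span (range (sm x) \<union> range (sm y))"
  have "dim (range (sm x) \<union> range (sm y)) \<le> dim (range (sm x)) + dim (range (sm y))"
  proof -
    have "span (range (sm x)) = range (sm x)" "span (range (sm y)) = range (sm y)"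
      using subspace_range_sm span_eq_iff by blast+
    then have "span (range (sm x) \<union> range (sm y)) = {a + b |a b. a \<in> range (sm x) \<and> b \<in> range (sm y)}"
      by (simp only: span_Un)
    then show ?thesis
      using dim_sums_Int[OF subspace_range_sm subspace_range_sm, of x y]
        dim_span[of "range (sm x) \<union> range (sm y)"] by simp
  qed
  also have "\<dots> < DIM('v)"
    using dim_range_sm[of x] dim_range_sm[of y] assms DIM_positive[where 'a='k] by linarith
  finally have "dim ?S < DIM('v)" by (simp add: dim_span)
  then obtain a where a: "a \<noteq> 0" "\<And>y. y \<in> ?S \<Longrightarrow> orthogonal a y"
    using orthogonal_to_subspace_exists[of "range (sm x) \<union> range (sm y)"] by (auto simp: dim_span)
  have "hp x a = 0" "hp y a = 0"
    using a(2)[OF span_base] by (auto intro!: hp_eqI simp: orthogonal_def inner_commute[of _ a])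
  then have "hp x (a /\<^sub>R norm a) = 0" "hp y (a /\<^sub>R norm a) = 0" by (auto simp: hp_linear)
  then show ?thesis using a(1) hp_zero_commute by (intro exI[of _ "a /\<^sub>R norm a"]) auto
qed

text \<open>The component of \<open>v\<close> orthogonal to the line of \<open>u\<close> is nonzero
  and has squared length 1 - |h|^2.\<close>

lemma norm_hp_less:
  assumes "norm u = 1" "norm v = 1" "v \<notin> range (sm u)"
  shows "norm (hp u v) < 1"
proof -
  let ?h = "hp u v"
  have uu: "inner u u = 1" "inner v v = 1" using assms by (auto simp: norm_eq_1)
  have "v - sm u ?h \<noteq> 0" using assms(3) by auto
  then have "0 < inner (v - sm u ?h) (v - sm u ?h)" by simp
  also have "inner (v - sm u ?h) (v - sm u ?h) = 1 - inner ?h ?h"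
  proof -
    have "inner (sm u ?h) v = inner ?h ?h" "inner v (sm u ?h) = inner ?h ?h"
      by (metis inner_hp inner_commute)+
    moreover have "inner (sm u ?h) (sm u ?h) = inner ?h ?h"
      by (simp add: inner_sm_sm uu)
    ultimately show ?thesis by (simp add: inner_diff_left inner_diff_right uu)
  qed
  finally have "(norm ?h)\<^sup>2 < 1" by (simp add: power2_norm_eq_inner)
  then show ?thesis using abs_square_less_1[of "norm ?h"] by simp
qed

end

section \<open>Chains of planes\<close>

text \<open>Requiring a nonzero source in every step makes consecutive planes share a nonzero
  vector. The zero vector lies in every plane and is treated apart.\<close>

lemma chain_imp_transitivity:
  assumes sub: "\<And>W. W \<in> G \<Longrightarrow> subspace W"
    and cover: "\<And>x. \<exists>W\<in>G. x \<in> W"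
    and conn: "\<And>x y. x \<noteq> 0 \<Longrightarrow> y \<noteq> 0 \<Longrightarrow> (\<lambda>x y. x \<noteq> 0 \<and> (\<exists>W\<in>G. x \<in> W \<and> y \<in> W))\<^sup>*\<^sup>* x y"
  shows "transitivity_property G"
  unfolding transitivity_property_def
proof (intro allI)
  fix x y :: 'a
  let ?R = "\<lambda>x y. x \<noteq> 0 \<and> (\<exists>W\<in>G. x \<in> W \<and> y \<in> W)"
  let ?P = "\<lambda>x y. \<exists>k (W :: nat \<Rightarrow> 'a set). k \<ge> 1 \<and> (\<forall>i<k. W i \<in> G) \<and>
        x \<in> W 0 \<and> y \<in> W (k - 1) \<and>
        (\<forall>i. Suc i < k \<longrightarrow> dim (W i \<inter> W (Suc i)) > 0)"
  have single: "?P a b" if "W \<in> G" "a \<in> W" "b \<in> W" for a b W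
    using that by (intro exI[of _ 1] exI[of _ "\<lambda>_. W"]) auto
  show "?P x y"
  proof (cases "x = 0 \<or> y = 0")
    case True
    then obtain z where "{x, y} \<subseteq> {0, z}" by blast
    moreover obtain W where "W \<in> G" "z \<in> W" using cover by blast
    moreover have "0 \<in> W" using sub \<open>W \<in> G\<close> subspace_0 by blast
    ultimately show ?thesis by (intro single[of W]) auto
  next
    case False
    have "?P x y" if "?R\<^sup>*\<^sup>* x y" "y \<noteq> 0" for x
      using that(1)
    proof (induction rule: converse_rtranclp_induct)
      case base
      show ?case using cover[of y] single[of _ y y] by blast
    next
      case (step x z)
      from step.IH obtain k W where W: "k \<ge> 1" "\<forall>i<k. W i \<in> G" "z \<in> W 0" "y \<in> W (k - 1)"
        "\<forall>i. Suc i < k \<longrightarrow> dim (W i \<inter> W (Suc i)) > 0" by blast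
      from step.hyps obtain W' where W': "W' \<in> G" "x \<in> W'" "z \<in> W'" by blast
      show ?case
      proof (cases "z = 0")
        case True
        \<comment> \<open>Only possible when \<open>z = y\<close>, as every source of an edge is nonzero.\<close>
        then have "z = y" using step.hyps(2) by (auto elim: converse_rtranclpE)
        then show ?thesis using W' single by blast
      next
        case False
        \<comment> \<open>The new plane \<open>W'\<close> is put in front of the chain; it meets
          \<open>W 0\<close> in the nonzero vector \<open>z\<close>.\<close>
        let ?V = "case_nat W' W"
        have "dim (W' \<inter> W 0) > 0"
          using False W'(3) W(3) by (metis IntI dim_eq_0 gr0I singletonD subsetD)
        then have "\<forall>i. Suc i < Suc k \<longrightarrow> dim (?V i \<inter> ?V (Suc i)) > 0"
          using W(5) by (auto split: nat.split)
        moreover have "\<forall>i<Suc k. ?V i \<in> G" using W(2) W'(1) by (auto split: nat.split)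
        moreover have "y \<in> ?V (Suc k - 1)" using W(1,4) by (auto split: nat.split)
        ultimately show ?thesis using W'(2) by (intro exI[of _ "Suc k"] exI[of _ ?V] conjI) simp_all
      qed
    qed
    then show ?thesis using conn False by blast
  qed
qed

context herm_space
begin

text \<open>The assumption \<open>hom\<close> is what the group action supplies, and
  \<open>u\<close>, \<open>v\<close> witness a plane not contained in a line. Chains are built for
  nearby unit vectors, then for orthogonal ones, then for all unit vectors, and finally by
  scaling.\<close>

lemma transitivity_of_pair_homogeneous:
  assumes big: "DIM('v) \<ge> 3 * DIM('k)"
    and sub: "\<And>W. W \<in> G \<Longrightarrow> subspace W"
    and hom: "\<And>W u v x y. W \<in> G \<Longrightarrow> u \<in> W \<Longrightarrow> v \<in> W \<Longrightarrow> norm x = norm u \<Longrightarrow> norm y = norm v \<Longrightarrow>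
      hp x y = hp u v \<Longrightarrow> \<exists>W'\<in>G. x \<in> W' \<and> y \<in> W'"
    and W: "W \<in> G" "u \<in> W" "v \<in> W" "u \<noteq> 0" "v \<notin> range (sm u)"
  shows "transitivity_property G"
proof -
  define R where "R = (\<lambda>x y. x \<noteq> 0 \<and> (\<exists>W\<in>G. x \<in> W \<and> y \<in> W))"
  have v0: "v \<noteq> 0" using W(5) sm_linear(9)[of u] by (metis rangeI)
  define u' where "u' = u /\<^sub>R norm u"
  define v' where "v' = v /\<^sub>R norm v"
  define h where "h = hp u' v'"
  have unit: "norm u' = 1" "norm v' = 1" using W(4) v0 by (auto simp: u'_def v'_def)
  have inW: "u' \<in> W" "v' \<in> W"
    using W sub by (auto simp: u'_def v'_def subspace_scale)
  have "v' \<notin> range (sm u')"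
  proof
    assume "v' \<in> range (sm u')"
    then obtain q where "v' = sm u' q" by blast
    then have "norm v *\<^sub>R v' = sm u ((norm v / norm u) *\<^sub>R q)"
      by (simp add: u'_def sm_linear divide_inverse)
    then show False using v0 W(5) by (auto simp: v'_def)
  qed
  then have h1: "norm h < 1" unfolding h_def using norm_hp_less unit by blast
  have edge: "\<exists>W\<in>G. x \<in> W \<and> y \<in> W" if "norm x = 1" "norm y = 1" "hp x y = h" for x y
    using hom[OF W(1) inW] that unit by (simp add: h_def)
  have cover1: "\<exists>W\<in>G. x \<in> W" if "norm x = 1" for x
    using hom[OF W(1) inW(1) inW(1), of x x] unit that
    by (auto simp: hp_self norm_eq_1)
  have scale: "\<exists>W\<in>G. x \<in> W \<and> x /\<^sub>R norm x \<in> W" if x: "x \<noteq> 0" for x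
  proof -
    obtain W where "W \<in> G" "x /\<^sub>R norm x \<in> W" using cover1[of "x /\<^sub>R norm x"] x by auto
    moreover from this have "norm x *\<^sub>R (x /\<^sub>R norm x) \<in> W"
      using sub subspace_scale by blast
    ultimately show ?thesis using x by auto
  qed
  have near: "R\<^sup>*\<^sup>* x y" if x: "norm x = 1" and y: "norm y = 1" and "hp x y = c *\<^sub>R one" "hp y x = c *\<^sub>R one"
      and c: "2 * (norm h)\<^sup>2 \<le> 1 + c" "1 + c > 0" for x y c
  proof -
    obtain w where w: "norm w = 1" "hp w x = 0" "hp w y = 0" "hp x w = 0" "hp y w = 0"
      using exists_unit_orthogonal[OF big] by blast
    \<comment> \<open>The part \<open>z0\<close> of \<open>z\<close> has squared length 2 |h|^2 / (1
      + c), at most 1 by the bound on \<open>c\<close>; the multiple \<open>s\<close> of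
      \<open>w\<close> supplies the rest of the unit length.\<close>
    define s where "s = sqrt (1 - 2 * (norm h)\<^sup>2 / (1 + c))"
    have s: "s\<^sup>2 = 1 - 2 * (norm h)\<^sup>2 / (1 + c)" using c by (simp add: s_def)
    define z0 where "z0 = sm (x + y) ((1 / (1 + c)) *\<^sub>R h)"
    define z where "z = z0 + s *\<^sub>R w"
    have xx: "inner x x = 1" "inner y y = 1" using x y by (auto simp: norm_eq_1)
    have xy: "inner x y = c"
      using inner_one_hp[of x y] that(3) norm_one by (simp add: norm_eq_1)
    \<comment> \<open>As \<open>c\<close> is real, \<open>x\<close> and \<open>y\<close> have the
      same product 1 + c with x + y. Dividing by it in \<open>z0\<close> gives both of them the
      product \<open>h\<close> with \<open>z\<close>.\<close>
    have "hp x (x + y) = (1 + c) *\<^sub>R one" "hp y (x + y) = (1 + c) *\<^sub>R one"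
      using that by (auto simp: hp_linear hp_self xx scaleR_add_left)
    then have "hp x z = h" "hp y z = h"
      using w c by (auto simp: z_def z0_def hp_linear hp_sm mul_linear one_mul)
    moreover have "norm z = 1"
    proof -
      have "inner z0 w = 0"
        using inner_hp[of _ "x + y" w] w by (simp add: z0_def hp_linear)
      moreover have "inner z0 z0 = (2 + 2 * c) * ((1 / (1 + c))\<^sup>2 * (norm h)\<^sup>2)"
        by (simp add: z0_def inner_sm_sm inner_add_left inner_add_right xx xy inner_commute[of y x]
            power2_norm_eq_inner) (simp add: power2_eq_square)
      then have "inner z0 z0 = 2 * (norm h)\<^sup>2 / (1 + c)"
      proof -
        have "(2 + 2 * c) * ((1 / (1 + c))\<^sup>2 * H) = 2 * H / (1 + c)" if "1 + c = e" "e \<noteq> 0" for e H :: real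
        proof -
          have "2 + 2 * c = 2 * e" using that(1) by simp
          then show ?thesis unfolding that(1) using that(2) by (simp only:) (simp add: power2_eq_square)
        qed
        with c \<open>inner z0 z0 = _\<close> show ?thesis by simp
      qed
      moreover have "inner w w = 1" using w by (simp add: norm_eq_1)
      ultimately have "inner z z = 2 * (norm h)\<^sup>2 / (1 + c) + s\<^sup>2"
        by (simp add: z_def inner_add_left inner_add_right inner_commute[of w z0] power2_eq_square)
      then show ?thesis using s by (simp add: norm_eq_1)
    qed
    ultimately have "R x z" "R z y"
      using edge[of x z] edge[of y z] x y by (auto simp: R_def)
    then show ?thesis by (meson rtranclp.rtrancl_refl rtranclp.rtrancl_into_rtrancl)
  qed
  have orth: "R\<^sup>*\<^sup>* x y" if x: "norm x = 1" and y: "norm y = 1" and xy: "hp x y = 0" for x y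
  proof -
    \<comment> \<open>Since |h| < 1, the limit 2 strictly exceeds 2 |h|^2, so the bound required by
      \<open>near\<close> holds once the quarter circle is subdivided finely enough.\<close>
    have "(\<lambda>n. 1 + cos (pi / 2 / real n)) \<longlonglongrightarrow> 1 + cos 0"
      by (intro tendsto_intros tendsto_divide_0[OF tendsto_const] filterlim_real_at_infinity_sequentially)
    moreover have "2 * (norm h)\<^sup>2 < 1 + cos (0::real)"
      using h1 by (simp add: power_less_one_iff)
    ultimately have "\<forall>\<^sub>F n in sequentially. 2 * (norm h)\<^sup>2 < 1 + cos (pi / 2 / real n)"
      by (rule order_tendstoD)
    then have "\<forall>\<^sub>F n in sequentially. 2 * (norm h)\<^sup>2 < 1 + cos (pi / 2 / real n) \<and> n \<ge> 1"
      using eventually_ge_at_top[of 1] by (rule eventually_conj)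
    then obtain N where N: "2 * (norm h)\<^sup>2 < 1 + cos (pi / 2 / real N)" "N \<ge> 1"
      using eventually_happens' sequentially_bot by blast
    define t where "t = pi / 2 / real N"
    \<comment> \<open>The points \<open>X k\<close> run along the real quarter circle from
      \<open>x\<close> to \<open>y\<close> in \<open>N\<close> steps; successive points have the
      real product cos t in either order.\<close>
    define X where "X k = cos (real k * t) *\<^sub>R x + sin (real k * t) *\<^sub>R y" for k
    have xx: "inner x x = 1" "inner y y = 1" using x y by (auto simp: norm_eq_1)
    have yx: "hp y x = 0" using xy hp_zero_commute by blast
    have hpX: "hp (X k) (X l) = cos (real k * t - real l * t) *\<^sub>R one" for k l
      by (simp add: X_def hp_linear hp_self xx xy yx cos_diff scaleR_add_left mult.commute)
    have "inner (X k) (X k) = 1" for k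
      using inner_one_hp[of "X k" "X k"] norm_one by (simp add: hpX norm_eq_1)
    then have nX: "norm (X k) = 1" for k by (simp add: norm_eq_1)
    have "R\<^sup>*\<^sup>* (X 0) (X k)" for k
    proof (induction k)
      case (Suc k)
      have e: "real k * t - real (Suc k) * t = - t" "real (Suc k) * t - real k * t = t"
        by (auto simp: algebra_simps)
      have "hp (X k) (X (Suc k)) = cos t *\<^sub>R one" "hp (X (Suc k)) (X k) = cos t *\<^sub>R one"
        unfolding hpX e by auto
      moreover have "1 + cos t > 0"
        using N(1) unfolding t_def by (rule le_less_trans[rotated]) simp
      ultimately have "R\<^sup>*\<^sup>* (X k) (X (Suc k))"
        using N(1) nX by (intro near[of _ _ "cos t"]) (auto simp: t_def)
      with Suc show ?case by (rule rtranclp_trans)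
    qed simp
    moreover have "X 0 = x" "X N = y" using N(2) by (auto simp: X_def t_def)
    ultimately show ?thesis by metis
  qed
  have units: "R\<^sup>*\<^sup>* x y" if "norm x = 1" "norm y = 1" for x y
  proof -
    obtain w where "norm w = 1" "hp x w = 0" "hp w y = 0"
      using exists_unit_orthogonal[OF big] by blast
    then show ?thesis using orth[of x w] orth[of w y] that by (meson rtranclp_trans)
  qed
  show ?thesis
  proof (rule chain_imp_transitivity[OF sub], assumption, unfold R_def[symmetric])
    show "\<exists>W\<in>G. x \<in> W" for x
      using scale[of x] W(1) sub subspace_0 by (cases "x = 0") blast+
    show "R\<^sup>*\<^sup>* x y" if "x \<noteq> 0" "y \<noteq> 0" for x y
    proof -
      have "R x (x /\<^sub>R norm x)" using that scale by (auto simp: R_def)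
      moreover have "R\<^sup>*\<^sup>* (x /\<^sub>R norm x) (y /\<^sub>R norm y)" using that by (intro units) auto
      moreover have "R (y /\<^sub>R norm y) y" using that scale[of y] by (auto simp: R_def)
      ultimately show ?thesis
        by (meson converse_rtranclp_into_rtranclp rtranclp.rtrancl_into_rtrancl)
    qed
  qed
qed

end

section \<open>The special unitary group\<close>

text \<open>Complex scalars commute, so scaling from the left is also a right action.\<close>

interpretation cx: herm_space "(*)" 1 cnj "\<lambda>v c. c *s (v :: complex^'n)"
proof
  show "bilinear (\<lambda>v c. c *s (v :: complex^'n))"
    by (auto simp: bilinear_def linear_iff vec_eq_iff algebra_simps)
  show "bilinear ((*) :: complex \<Rightarrow> _)"
    by (auto simp: bilinear_def linear_iff algebra_simps)
next
  fix x :: "complex^'n" and q r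
  have "inner (q * z) (r * z) = inner z z * inner q r" for z :: complex
    by (simp add: inner_complex_def algebra_simps)
  then show "inner (q *s x) (r *s x) = inner x x * inner q r"
    by (simp add: inner_vec_def sum_distrib_right)
next
  fix x y :: "complex^'n" and q
  have "inner (q * a) b = inner a (cnj q * b)" for a b :: complex
    by (simp add: inner_complex_def algebra_simps)
  then show "inner (q *s x) y = inner x (cnj q *s y)"
    by (simp add: inner_vec_def)
qed (auto simp: inner_complex_def complex_eq_iff vec_eq_iff algebra_simps)

lemma hp_complex: "cx.hp x y = (\<Sum>i\<in>UNIV. cnj (x $ i) * y $ i)"
proof (rule cx.hp_eqI)
  fix r
  have "inner r (cnj a * b) = inner (r * a) b" for a b
    by (simp add: inner_complex_def algebra_simps)
  then show "inner r (\<Sum>i\<in>UNIV. cnj (x $ i) * y $ i) = inner (r *s x) y"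
    by (simp add: inner_vec_def inner_sum_right)
qed

text \<open>Since \<open>A\<close> preserves Hermitian products, the columns of its matrix are
  orthonormal; for a square matrix this left inverse is also a right inverse.\<close>

lemma matrix_of_unitary:
  fixes A :: "complex^'n \<Rightarrow> complex^'n"
  assumes "A \<in> cx.unitary"
  obtains U where "U ** cnj_transpose U = mat 1" "\<And>v. U *v v = A v"
proof -
  let ?U = "matrix A"
  have A: "linear A" "\<And>c v. A (c *s v) = c *s A v" using assms by (auto simp: cx.unitary_def)
  have "Vector_Spaces.linear (*s) (*s) A"
    using A linear_add[OF A(1)] by (simp add: Vector_Spaces.linear_iff vec.vector_space_axioms)
  note U = matrix_works[OF this]
  have "cnj_transpose ?U ** ?U = mat 1"
  proof -
    have "(cnj_transpose ?U ** ?U) $ i $ j = mat 1 $ i $ j" for i j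
    proof -
      have "(cnj_transpose ?U ** ?U) $ i $ j = cx.hp (A (axis i 1)) (A (axis j 1))"
        by (simp add: matrix_matrix_mult_def cnj_transpose_def hp_complex matrix_def)
      also have "\<dots> = cx.hp (axis i 1) (axis j 1)" by (rule cx.unitary_hp[OF assms])
      also have "\<dots> = mat 1 $ i $ j"
        by (simp add: hp_complex axis_def mat_def if_distrib[of cnj] if_distrib[of "\<lambda>z. z * _"] cong: if_cong)
      finally show ?thesis .
    qed
    then show ?thesis by (simp add: vec_eq_iff)
  qed
  then have "?U ** cnj_transpose ?U = mat 1" by (simp add: matrix_left_right_inverse)
  with U that show thesis by blast
qed

lemma det_cnj_transpose: "det (cnj_transpose U) = cnj (det U)"
proof -
  have "cnj_transpose U = transpose (\<chi> i j. cnj (U $ i $ j))"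
    by (simp add: cnj_transpose_def transpose_def)
  then have "det (cnj_transpose U) = det (\<chi> i j. cnj (U $ i $ j))" by (simp add: det_transpose)
  also have "\<dots> = cnj (det U)" by (simp add: det_def)
  finally show ?thesis .
qed

lemma cnj_transpose_mult: "cnj_transpose (A ** B) = cnj_transpose B ** cnj_transpose A"
  by (simp add: cnj_transpose_def matrix_matrix_mult_def vec_eq_iff mult.commute)

lemma cnj_transpose_cnj_transpose: "cnj_transpose (cnj_transpose U) = U"
  by (simp add: cnj_transpose_def vec_eq_iff)

lemma unitary_matrix_mult:
  assumes "A ** cnj_transpose A = mat 1" "B ** cnj_transpose B = mat 1"
  shows "(A ** B) ** cnj_transpose (A ** B) = mat 1"
proof -
  have "(A ** B) ** cnj_transpose (A ** B) = A ** (B ** cnj_transpose B) ** cnj_transpose A"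
    by (simp add: cnj_transpose_mult matrix_mul_assoc)
  then show ?thesis using assms by simp
qed

text \<open>The determinant of a unitary map is corrected by a rotation of the complex line
  through a vector \<open>w\<close> orthogonal to \<open>x\<close> and \<open>y\<close>.\<close>
lemma SU_pair_transitive:
  fixes x y u v :: "complex^'n"
  assumes n: "CARD('n) \<ge> 3" and "norm x = norm u" "norm y = norm v" "cx.hp x y = cx.hp u v"
  shows "\<exists>U\<in>SU. U *v u = x \<and> U *v v = y"
proof -
  obtain A where A: "A \<in> cx.unitary" "A u = x" "A v = y"
    using cx.unitary_pair_transitive[OF assms(2-4)] by blast
  from matrix_of_unitary[OF A(1)] obtain U
    where U: "U ** cnj_transpose U = mat 1" "\<And>v. U *v v = A v" by blast
  obtain w where w: "norm w = 1" "cx.hp w x = 0" "cx.hp w y = 0"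
    using cx.exists_unit_orthogonal[where x=x and y=y] n by auto
  fix k :: 'n
  have "norm w = norm (axis k 1 :: complex^'n)" using w by simp
  from cx.unitary_reflection[OF this] obtain B where B: "B \<in> cx.unitary" "B (axis k 1) = w" by blast
  from matrix_of_unitary[OF B(1)] obtain P
    where P: "P ** cnj_transpose P = mat 1" "\<And>v. P *v v = B v" by blast
  \<comment> \<open>As |det U| = 1, the conjugate of det U is its inverse.\<close>
  define l where "l = cnj (det U)"
  have "det (U ** cnj_transpose U) = 1" using U(1) by simp
  then have l: "l * det U = 1" "cnj l = det U" "l * cnj l = 1"
    by (simp_all add: det_mul det_cnj_transpose l_def mult.commute)
  define D :: "complex^'n^'n" where
    "D = (\<chi> i j. if i = j then (if i = k then l else 1) else 0)"
  have D: "D ** cnj_transpose D = mat 1"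
    using l(3) by (auto simp: D_def cnj_transpose_def matrix_matrix_mult_def mat_def vec_eq_iff
        if_distrib[of cnj] if_distrib[of "\<lambda>z. _ * z"] if_distrib[of "\<lambda>z. z * _"] cong: if_cong)
  have detD: "det D = l"
    by (subst det_diagonal) (simp_all add: D_def)
  have fixD: "D *v z = z" if "z $ k = 0" for z
    using that by (auto simp: D_def matrix_vector_mult_def vec_eq_iff if_distrib[of "\<lambda>z. z * _"] cong: if_cong)
  \<comment> \<open>Because \<open>P\<close> sends the basis vector at \<open>k\<close> to
    \<open>w\<close>, this matrix multiplies \<open>w\<close> by \<open>l\<close> and fixes the
    orthogonal complement of \<open>w\<close>.\<close>
  let ?V = "(P ** D) ** cnj_transpose P"
  have P': "cnj_transpose P ** cnj_transpose (cnj_transpose P) = mat 1"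
    using P(1) by (simp add: cnj_transpose_cnj_transpose matrix_left_right_inverse)
  have V: "?V ** cnj_transpose ?V = mat 1"
    by (intro unitary_matrix_mult P D P')
  have Pk: "P $ j $ k = w $ j" for j
  proof -
    have "(P *v axis k 1) $ j = P $ j $ k"
      by (simp add: matrix_vector_mult_def axis_def if_distrib[of "\<lambda>z. _ * z"] cong: if_cong)
    then show ?thesis using P(2) B(2) by simp
  qed
  have fixV: "?V *v z = z" if "cx.hp w z = 0" for z
  proof -
    \<comment> \<open>Column \<open>k\<close> of \<open>P\<close> is \<open>w\<close>, so this
      coordinate is the Hermitian product of \<open>w\<close> and \<open>z\<close>.\<close>
    have "(cnj_transpose P *v z) $ k = 0"
      using that by (simp add: matrix_vector_mult_def cnj_transpose_def hp_complex Pk)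
    then have "D *v (cnj_transpose P *v z) = cnj_transpose P *v z" by (rule fixD)
    then show ?thesis using P(1) by (simp add: matrix_vector_mul_assoc[symmetric])
      (simp add: matrix_vector_mul_assoc)
  qed
  have "det (?V ** U) = (det P * det (cnj_transpose P)) * (l * det U)"
    by (simp add: det_mul detD)
  also have "\<dots> = 1" using arg_cong[OF P(1), of det] l(1) by (simp add: det_mul)
  finally have "det (?V ** U) = 1" .
  then have "?V ** U \<in> SU" using unitary_matrix_mult[OF V U(1)] by (simp add: SU_def)
  moreover have "(?V ** U) *v u = x" "(?V ** U) *v v = y"
    using fixV[OF w(2)] fixV[OF w(3)] U(2) A by (simp_all add: matrix_vector_mul_assoc[symmetric])
  ultimately show ?thesis by blast
qed

text \<open>If every plane lies in the complex line of each of its nonzero vectors, counting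
  dimensions gives p = 2 and makes the plane equal to that line. Transitivity on vectors of equal
  length then produces every line, which is the excluded family.\<close>

lemma transitivity_SU:
  fixes G :: "(complex^'n) set set"
  assumes "p \<ge> 2" and n: "CARD('n) \<ge> 3"
    and ne: "G \<noteq> {}" and sub: "G \<subseteq> Grass p" and inv: "SU_invariant G"
    and exc: "\<not> (p = 2 \<and> G = complex_lines)"
  shows "transitivity_property G"
proof -
  have hom: "\<exists>W'\<in>G. x \<in> W' \<and> y \<in> W'"
    if WG: "W \<in> G" and uv: "u \<in> W" "v \<in> W" and
      eq: "norm x = norm u" "norm y = norm v" "cx.hp x y = cx.hp u v" for W u v x y
  proof -
    from SU_pair_transitive[OF n eq] obtain U where
      U: "U \<in> SU" "U *v u = x" "U *v v = y" by blast
    then have "(\<lambda>v. U *v v) ` W \<in> G" using inv WG by (auto simp: SU_invariant_def)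
    moreover have "x \<in> (\<lambda>v. U *v v) ` W" "y \<in> (\<lambda>v. U *v v) ` W"
      using U uv by auto
    ultimately show ?thesis by (intro bexI[of _ "(\<lambda>v. U *v v) ` W"] conjI)
  qed
  have subsp: "subspace W" "dim W = p" if "W \<in> G" for W
    using that sub by (auto simp: Grass_def)
  show ?thesis
  proof (cases "\<exists>W\<in>G. \<exists>u\<in>W. \<exists>v\<in>W. u \<noteq> 0 \<and> v \<notin> range (\<lambda>c. c *s u)")
    case True
    then show ?thesis
      using cx.transitivity_of_pair_homogeneous[OF _ subsp(1) hom] n by fastforce
  next
    case False
    have line: "p = 2 \<and> W = range (\<lambda>c. c *s u)" if W: "W \<in> G" and u: "u \<in> W" "u \<noteq> 0" for W u
    proof -
      have WR: "W \<subseteq> range (\<lambda>c. c *s u)" using False W u by blast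
      have "dim W \<le> dim (range (\<lambda>c. c *s u))" using WR by (rule dim_subset)
      moreover have le: "dim (range (\<lambda>c. c *s u)) \<le> 2" using cx.dim_range_sm[of u] by simp
      ultimately have "p = 2" using subsp(2)[OF W] \<open>p \<ge> 2\<close> by simp
      moreover have "W = range (\<lambda>c. c *s u)"
        using le subsp(2)[OF W] \<open>p \<ge> 2\<close>
        by (intro subspace_dim_equal subsp W WR cx.subspace_range_sm) simp
      ultimately show ?thesis ..
    qed
    have nz: "\<exists>u\<in>W. u \<noteq> 0" if W: "W \<in> G" for W
      using subsp(2)[OF W] \<open>p \<ge> 2\<close> dim_eq_0[of W] by auto
    have "complex_lines \<subseteq> G"
    proof
      fix L :: "(complex^'n) set" assume "L \<in> complex_lines"
      then obtain v where v: "v \<noteq> 0" "L = range (\<lambda>c. c *s v)" by (auto simp: complex_lines_def)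
      obtain W u where W: "W \<in> G" "u \<in> W" "u \<noteq> 0" using ne nz by blast
      \<comment> \<open>Rescaled to the length of \<open>v\<close>, the vector can be moved to
        \<open>v\<close> by \<open>hom\<close>, applied to a pair of equal vectors.\<close>
      let ?u = "(norm v / norm u) *\<^sub>R u"
      have u': "?u \<in> W" "norm v = norm ?u" using W subsp by (auto simp: subspace_scale)
      then have "cx.hp v v = cx.hp ?u ?u"
        by (simp only: cx.hp_self power2_norm_eq_inner[symmetric])
      from hom[OF W(1) u'(1) u'(1) u'(2) u'(2) this] line v show "L \<in> G" by metis
    qed
    moreover have "G \<subseteq> complex_lines"
      using nz line unfolding complex_lines_def by blast
    ultimately have "G = complex_lines" by (rule equalityI[rotated])
    moreover obtain W u where "W \<in> G" "u \<in> W" "u \<noteq> 0" using ne nz by blast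
    then have "p = 2" using line by blast
    ultimately show ?thesis using exc by simp
  qed
qed

section \<open>Quaternions\<close>

definition hone :: "real^4" where "hone = vector [1, 0, 0, 0]"

definition hconj :: "real^4 \<Rightarrow> real^4" where
  "hconj q = vector [q$1, - q$2, - q$3, - q$4]"

lemma hmult_nth:
  "hmult p q $ 1 = p$1*q$1 - p$2*q$2 - p$3*q$3 - p$4*q$4"
  "hmult p q $ 2 = p$1*q$2 + p$2*q$1 + p$3*q$4 - p$4*q$3"
  "hmult p q $ 3 = p$1*q$3 - p$2*q$4 + p$3*q$1 + p$4*q$2"
  "hmult p q $ 4 = p$1*q$4 + p$2*q$3 - p$3*q$2 + p$4*q$1"
  by (simp_all add: hmult_def vector_def)

lemma hone_nth: "hone $ 1 = 1" "hone $ 2 = 0" "hone $ 3 = 0" "hone $ 4 = 0"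
  by (simp_all add: hone_def vector_def)

lemma hconj_nth: "hconj q $ 1 = q$1" "hconj q $ 2 = - q$2" "hconj q $ 3 = - q$3" "hconj q $ 4 = - q$4"
  by (simp_all add: hconj_def vector_def)

lemmas quat_simps = vec_eq_iff forall_4 hmult_nth hone_nth hconj_nth inner_vec_def sum_4

interpretation hq: herm_space hmult hone hconj "hsmult :: (real^4)^'n \<Rightarrow> _"
proof
  show "bilinear hmult"
    by (auto simp: bilinear_def linear_iff quat_simps algebra_simps)
  then show "bilinear (hsmult :: (real^4)^'n \<Rightarrow> _)"
    by (auto simp: bilinear_def linear_iff vec_eq_iff[where 'b='n] hsmult_def)
next
  fix v :: "(real^4)^'n" and a b c :: "real^4"
  show "hmult hone a = a" "hmult a hone = a" by (auto simp: quat_simps)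
  have assoc: "hmult (hmult a b) c = hmult a (hmult b c)" for a b c
    by (simp add: quat_simps algebra_simps)
  then show "hmult (hmult a b) c = hmult a (hmult b c)" .
  show "hsmult v hone = v" by (simp add: hsmult_def vec_eq_iff[where 'b='n]) (simp add: quat_simps)
  show "hsmult (hsmult v a) b = hsmult v (hmult a b)"
    by (simp add: hsmult_def assoc)
  show "norm hone = 1" by (simp add: norm_eq_1 quat_simps)
  show "hmult a (hconj a) = inner a a *\<^sub>R hone" "hmult (hconj a) a = inner a a *\<^sub>R hone"
    by (simp_all add: quat_simps algebra_simps)
  show "inner (hmult a b) (hmult a b) = inner a a * inner b b"
    by (simp add: quat_simps algebra_simps)
  show "inner (hmult a b) c = inner a (hmult c (hconj b))"
    by (simp add: quat_simps algebra_simps)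
next
  fix x y :: "(real^4)^'n" and q r :: "real^4"
  have "inner (hmult a q) (hmult a r) = inner a a * inner q r" for a
    by (simp add: quat_simps algebra_simps)
  then show "inner (hsmult x q) (hsmult x r) = inner x x * inner q r"
    by (simp add: inner_vec_def[where 'b='n] hsmult_def sum_distrib_right)
  have "inner (hmult a q) b = inner a (hmult b (hconj q))" for a b
    by (simp add: quat_simps algebra_simps)
  then show "inner (hsmult x q) y = inner x (hsmult y (hconj q))"
    by (simp add: inner_vec_def[where 'b='n] hsmult_def)
qed

lemma Sp_eq_unitary: "Sp = hq.unitary"
  by (simp add: Sp_def hq.unitary_def)

lemma norm_hmult: "norm (hmult a b) = norm a * norm b"
  by (simp add: norm_eq_sqrt_inner hq.inner_mul_mul real_sqrt_mult)

lemma norm_hconj: "norm (hconj a) = norm a"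
  by (simp add: norm_eq_sqrt_inner quat_simps)

text \<open>After normalizing to \<open>e = e' = 1\<close> one has to conjugate the imaginary unit \<open>m\<close> to
  \<open>m'\<close>, which \<open>m + m'\<close> does because \<open>m (m + m') = m m' - 1 = (m + m') m'\<close>;
  this breaks down only for \<open>m' = - m\<close>, whence the sign.\<close>
lemma orthonormal_pair_rotation:
  assumes "norm e = 1" "norm f = 1" "inner e f = 0" "norm e' = 1" "norm f' = 1" "inner e' f' = 0"
  shows "\<exists>a b. norm a = 1 \<and> norm b = 1 \<and> hmult (hmult a e) b = e' \<and>
    (hmult (hmult a f) b = f' \<or> hmult (hmult a f) b = - f')"
proof -
  have cancel: "hmult (hconj q) (hmult q z) = z" "hmult q (hmult (hconj q) z) = z"
    if "norm q = 1" for q z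
    using that
    by (simp_all add: hq.mul_assoc[symmetric] hq.conj_mul hq.mul_conj norm_eq_1 hq.mul_linear hq.one_mul)
  \<comment> \<open>The product has real part (e, f) = 0 and length 1, and a unit imaginary
    quaternion squares to -1.\<close>
  have square: "hmult (hmult (hconj e) f) (hmult (hconj e) f) = - hone"
    if "norm e = 1" "norm f = 1" "inner e f = 0" for e f
  proof -
    let ?m = "hmult (hconj e) f"
    have "inner ?m ?m = 1"
      using that norm_hmult[of "hconj e" f] by (simp add: norm_hconj norm_eq_1[symmetric])
    moreover have "inner hone ?m = inner e f" by (simp add: quat_simps algebra_simps)
    then have "hconj ?m = - ?m" using that(3) by (simp add: quat_simps)
    ultimately have "- hmult ?m ?m = hone"
      using hq.mul_conj[of ?m] by (simp only: hq.mul_linear scaleR_one)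
    then show ?thesis by (metis minus_minus)
  qed
  define m where "m = hmult (hconj e) f"
  define m' where "m' = hmult (hconj e') f'"
  have mm: "hmult m m = - hone" "hmult m' m' = - hone"
    using square assms by (auto simp: m_def m'_def)
  have f: "f = hmult e m" "f' = hmult e' m'" using assms cancel by (auto simp: m_def m'_def)
  show ?thesis
  proof (cases "m + m' = 0")
    case True
    then have "m = - m'" by (simp add: eq_neg_iff_add_eq_0)
    \<comment> \<open>Left multiplication by \<open>?a\<close> takes e to e', hence f = e m to e' m
      = - e' m' = - f'.\<close>
    let ?a = "hmult e' (hconj e)"
    have "hmult (hmult ?a e) hone = e'" "hmult (hmult ?a f) hone = - f'"
      using assms cancel unfolding f \<open>m = - m'\<close>
      by (simp_all add: hq.mul_assoc hq.mul_one hq.mul_linear hq.conj_mul norm_eq_1)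
    then show ?thesis using assms hq.norm_one
      by (intro exI[of _ ?a] exI[of _ hone]) (simp add: norm_hmult norm_hconj)
  next
    case False
    define b where "b = (m + m') /\<^sub>R norm (m + m')"
    have b: "norm b = 1" using False by (simp add: b_def)
    have "hmult m b = hmult b m'"
      by (simp add: b_def hq.mul_linear mm algebra_simps)
    \<comment> \<open>This choice solves a e b = e'; then a f b = e' b^-1 m b = e' m' = f'.\<close>
    let ?a = "hmult (hmult e' (hconj b)) (hconj e)"
    have "hmult (hmult ?a e) b = e'" "hmult (hmult ?a f) b = f'"
      unfolding f using assms b cancel \<open>hmult m b = hmult b m'\<close>
      by (simp_all add: hq.mul_assoc hq.mul_one hq.mul_linear hq.conj_mul norm_eq_1)
    then show ?thesis using assms b
      by (intro exI[of _ ?a] exI[of _ b]) (simp add: norm_hmult norm_hconj)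
  qed
qed

section \<open>Planes inside a quaternion line\<close>

text \<open>Dimension 2 follows from orthonormal bases, where the sign of f' does not change the
  span; dimension 3 from moving the unit normal; dimension 4 is the whole space. Inclusion of the
  image suffices, since the maps are injective and the dimensions agree.\<close>

lemma subspace_rotation:
  fixes P P' :: "(real^4) set"
  assumes P: "subspace P" "subspace P'" "dim P = p" "dim P' = p" and p: "p \<in> {2, 3, 4}"
  shows "\<exists>a b. norm a = 1 \<and> norm b = 1 \<and> (\<lambda>x. hmult (hmult a x) b) ` P = P'"
proof -
  have lin: "linear (\<lambda>x. hmult (hmult a x) b)" for a b
    by (rule linearI) (simp_all add: hq.mul_linear)
  have orth: "orthogonal_transformation (\<lambda>x. hmult (hmult a x) b)"
    if "norm a = 1" "norm b = 1" for a b
    using lin that by (simp add: orthogonal_transformation norm_hmult)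
  have "\<exists>a b. norm a = 1 \<and> norm b = 1 \<and> (\<lambda>x. hmult (hmult a x) b) ` P \<subseteq> P'"
  proof -
    consider "p = 2" | "p = 3" | "p = 4" using p by blast
    then show ?thesis
    proof cases
      case 1
      have basis: "\<exists>e f. norm e = 1 \<and> norm f = 1 \<and> inner e f = 0 \<and> span {e, f} = Q"
        if Q: "subspace Q" "dim Q = 2" for Q :: "(real^4) set"
      proof -
        obtain B where B: "B \<subseteq> Q" "pairwise orthogonal B" "\<forall>x\<in>B. norm x = 1" "card B = dim Q" "span B = Q"
          by (rule orthonormal_basis_subspace[OF Q(1)]) blast
        then have "card B = 2" using Q(2) by simp
        then obtain e f where "B = {e, f}" "e \<noteq> f" unfolding card_2_iff by blast
        then have "norm e = 1" "norm f = 1" "inner e f = 0" "span {e, f} = Q"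
          using B by (auto simp: pairwise_def orthogonal_def)
        then show ?thesis by blast
      qed
      obtain e f where e: "norm e = 1" "norm f = 1" "inner e f = 0" "span {e, f} = P"
        using basis[OF P(1)] P(3) 1 by blast
      obtain e' f' where e': "norm e' = 1" "norm f' = 1" "inner e' f' = 0" "span {e', f'} = P'"
        using basis[OF P(2)] P(4) 1 by blast
      from orthonormal_pair_rotation[OF e(1-3) e'(1-3)] obtain a b where
        ab: "norm a = 1" "norm b = 1" "hmult (hmult a e) b = e'"
        "hmult (hmult a f) b = f' \<or> hmult (hmult a f) b = - f'" by blast
      have "e' \<in> P'" "f' \<in> P'" using e'(4) by (auto simp: span_base)
      then have "(\<lambda>x. hmult (hmult a x) b) ` {e, f} \<subseteq> P'"
        using ab P(2) by (auto simp: subspace_neg)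
      then have "(\<lambda>x. hmult (hmult a x) b) ` span {e, f} \<subseteq> P'"
        using P(2) by (metis lin linear_span_image span_minimal)
      then show ?thesis using ab e(4) by blast
    next
      case 2
      have normal: "\<exists>e. norm e = 1 \<and> Q = {x. inner e x = 0}"
        if Q: "subspace Q" "dim Q = 3" for Q :: "(real^4) set"
      proof -
        obtain a where a: "a \<noteq> 0" "\<And>y. y \<in> span Q \<Longrightarrow> orthogonal a y"
          using orthogonal_to_subspace_exists[of Q] Q by auto
        let ?e = "a /\<^sub>R norm a"
        have e: "norm ?e = 1" using a by simp
        have "Q \<subseteq> {x. inner ?e x = 0}" using a(2) by (auto simp: orthogonal_def span_base)
        moreover have "dim {x. inner ?e x = 0} = 3"
          using dim_hyperplane[of ?e] a(1) by simp
        ultimately have "Q = {x. inner ?e x = 0}"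
          using Q by (intro subspace_dim_equal subspace_hyperplane) auto
        with e show ?thesis by blast
      qed
      obtain e where e: "norm e = 1" "P = {x. inner e x = 0}"
        using normal[OF P(1)] P(3) 2 by blast
      obtain e' where e': "norm e' = 1" "P' = {x. inner e' x = 0}"
        using normal[OF P(2)] P(4) 2 by blast
      let ?a = "hmult e' (hconj e)"
      have a: "norm ?a = 1" using e e' by (simp add: norm_hmult norm_hconj)
      have "hmult (hmult ?a e) hone = e'"
        using e by (simp add: hq.mul_assoc hq.mul_one hq.mul_linear hq.conj_mul norm_eq_1)
      then have "inner e' (hmult (hmult ?a x) hone) = inner e x" for x
        using orth[OF a hq.norm_one] by (metis orthogonal_transformation_def)
      then have "(\<lambda>x. hmult (hmult ?a x) hone) ` P \<subseteq> P'" using e e' by auto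
      then show ?thesis using a hq.norm_one by blast
    next
      case 3
      then have "P' = UNIV" using P dim_eq_full[of P'] by simp (metis span_eq_iff)
      then show ?thesis using hq.norm_one by blast
    qed
  qed
  then obtain a b where ab: "norm a = 1" "norm b = 1" "(\<lambda>x. hmult (hmult a x) b) ` P \<subseteq> P'" by blast
  have "dim ((\<lambda>x. hmult (hmult a x) b) ` P) = dim P"
    using orthogonal_transformation_inj[OF orth[OF ab(1,2)]] lin
    by (intro dim_image_eq) (auto intro: inj_on_subset)
  then have "(\<lambda>x. hmult (hmult a x) b) ` P = P'"
    using P by (intro subspace_dim_equal ab linear_subspace_image lin) auto
  with ab show ?thesis by blast
qed

text \<open>Multiplying a unit vector by quaternions is injective and linear, so a plane in its line
  pulls back to a subspace of the quaternions of the same dimension, where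
  \<open>subspace_rotation\<close> applies.\<close>

lemma in_quaternion_line_param:
  assumes "W \<in> in_quaternion_line p"
  obtains v P where "norm v = 1" "subspace P" "dim P = p" "W = hsmult v ` P"
proof -
  obtain u where u: "u \<noteq> 0" "W \<subseteq> range (hsmult u)" and W: "subspace W" "dim W = p"
    using assms by (auto simp: in_quaternion_line_def Grass_def)
  let ?v = "u /\<^sub>R norm u"
  have v: "norm ?v = 1" using u by simp
  have "hsmult u q = hsmult ?v (norm u *\<^sub>R q)" for q
    using u by (simp add: hq.sm_linear)
  then have WR: "W \<subseteq> range (hsmult ?v)" using u(2) by (auto simp only: subset_iff image_iff) blast
  define P where "P = hsmult ?v -` W"
  have "W = hsmult ?v ` P" using WR by (auto simp: P_def)
  moreover have "subspace P"
    unfolding P_def by (rule linear_subspace_vimage[OF hq.linear_sm_right W(1)])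
  moreover have "inj (hsmult ?v)"
    unfolding linear_injective_0[OF hq.linear_sm_right]
    using v hq.norm_sm[of ?v] by (metis mult_1 norm_eq_zero)
  then have "dim (hsmult ?v ` P) = dim P"
    by (intro dim_image_eq hq.linear_sm_right) (auto intro: inj_on_subset)
  ultimately show thesis using that v W by metis
qed

section \<open>Families invariant under the symplectic groups\<close>

lemma transitivity_Sp:
  fixes G :: "((real^4)^'n) set set"
  assumes n: "CARD('n) \<ge> 3" and sub: "G \<subseteq> Grass p" and inv: "Sp_invariant G"
    and W: "W \<in> G" "u \<in> W" "v \<in> W" "u \<noteq> 0" "v \<notin> range (hsmult u)"
  shows "transitivity_property G"
proof (rule hq.transitivity_of_pair_homogeneous[OF _ _ _ W])
  show "3 * DIM(real^4) \<le> DIM((real^4)^'n)" using n by simp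
  show "subspace W" if "W \<in> G" for W using that sub by (auto simp: Grass_def)
  show "\<exists>W'\<in>G. x \<in> W' \<and> y \<in> W'"
    if WG: "W \<in> G" and uv: "u \<in> W" "v \<in> W" and
      eq: "norm x = norm u" "norm y = norm v" "hq.hp x y = hq.hp u v" for W u v x y
  proof -
    from hq.unitary_pair_transitive[OF eq] obtain A where
      A: "A \<in> Sp" "A u = x" "A v = y" by (auto simp: Sp_eq_unitary)
    then have "A ` W \<in> G" using inv WG by (auto simp: Sp_invariant_def)
    moreover have "x \<in> A ` W" "y \<in> A ` W" using A uv by auto
    ultimately show ?thesis by (intro bexI[of _ "A ` W"] conjI)
  qed
qed

text \<open>A plane outside all quaternion lines is in particular not contained in the line of one
  of its own nonzero vectors, which yields the pair for \<open>transitivity_Sp\<close>.\<close>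

lemma Sp_invariant_dichotomy:
  fixes G :: "((real^4)^'n) set set"
  assumes "p \<ge> 2" and n: "CARD('n) \<ge> 3" and sub: "G \<subseteq> Grass p" and inv: "Sp_invariant G"
  shows "transitivity_property G \<or> G \<subseteq> in_quaternion_line p"
proof (rule disjCI)
  assume not_line: "\<not> G \<subseteq> in_quaternion_line p"
  then obtain W where W: "W \<in> G" "W \<notin> in_quaternion_line p" by blast
  then have "dim W = p" using sub by (auto simp: Grass_def)
  then obtain u where u: "u \<in> W" "u \<noteq> 0" using \<open>p \<ge> 2\<close> dim_eq_0[of W] by auto
  then have "\<not> W \<subseteq> range (hsmult u)"
    using W sub by (auto simp: in_quaternion_line_def)
  then obtain v where "v \<in> W" "v \<notin> range (hsmult u)" by blast
  with transitivity_Sp[OF n sub inv] W u show "transitivity_property G" by blast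
qed

text \<open>A quaternion line has real dimension at most 4, which rules out the second alternative
  of the dichotomy for nonempty families with p at least 5.\<close>

lemma dim_in_quaternion_line:
  assumes "W \<in> in_quaternion_line p" shows "p \<le> 4"
proof -
  obtain v where v: "W \<subseteq> range (hsmult v)" "dim W = p"
    using assms by (auto simp: in_quaternion_line_def Grass_def)
  then show ?thesis using dim_subset[OF v(1)] hq.dim_range_sm[of v] by simp
qed

lemma Sp_invariant_if_SpSp1_invariant:
  fixes G :: "((real^4)^'n) set set"
  assumes "SpSp1_invariant G" shows "Sp_invariant G"
  unfolding Sp_invariant_def
proof (intro ballI)
  fix A :: "(real^4)^'n \<Rightarrow> (real^4)^'n" and W :: "((real^4)^'n) set" assume "A \<in> Sp" "W \<in> G"
  then have "(\<lambda>v. hsmult (A v) hone) ` W \<in> G"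
    using assms hq.norm_one by (auto simp: SpSp1_invariant_def)
  then show "A ` W \<in> G" by (simp add: hq.sm_one)
qed

text \<open>Write W = v P and W' = v' P' with a P b = P'. The left factor \<open>a\<close> is
  absorbed by choosing \<open>A\<close> with A v = v' a, and the right factor \<open>b\<close> is
  the scalar from Sp(1); together they send v x to v' (a x b).\<close>

lemma in_quaternion_line_single_orbit:
  fixes G :: "((real^4)^'n) set set"
  assumes p: "p \<in> {2, 3, 4}" and "G \<noteq> {}" and sub: "G \<subseteq> in_quaternion_line p"
    and inv: "SpSp1_invariant G"
  shows "G = in_quaternion_line p"
proof
  show "in_quaternion_line p \<subseteq> G"
  proof
    fix W' :: "((real^4)^'n) set" assume "W' \<in> in_quaternion_line p"
    then obtain v' P' where W': "norm v' = 1" "subspace P'" "dim P' = p" "W' = hsmult v' ` P'"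
      by (rule in_quaternion_line_param)
    obtain W where "W \<in> G" using assms by blast
    then have "W \<in> in_quaternion_line p" using sub by blast
    then obtain v P where W: "norm v = 1" "subspace P" "dim P = p" "W = hsmult v ` P"
      by (rule in_quaternion_line_param)
    obtain a b where ab: "norm a = 1" "norm b = 1" "(\<lambda>x. hmult (hmult a x) b) ` P = P'"
      using subspace_rotation[OF W(2) W'(2) W(3) W'(3) p] by blast
    have "norm (hsmult v' a) = norm v" using W W' ab by (simp add: hq.norm_sm)
    from hq.unitary_reflection[OF this] obtain A where A: "A \<in> Sp" "A v = hsmult v' a"
      unfolding Sp_eq_unitary by blast
    have "hsmult (A (hsmult v x)) b = hsmult v' (hmult (hmult a x) b)" for x
      using A by (simp add: Sp_def hq.sm_sm)
    then have "(\<lambda>w. hsmult (A w) b) ` W = hsmult v' ` (\<lambda>x. hmult (hmult a x) b) ` P"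
      unfolding W(4) by (simp add: image_image)
    also have "\<dots> = W'" using ab W' by simp
    finally show "W' \<in> G"
      using inv A(1) ab(2) \<open>W \<in> G\<close> by (auto simp: SpSp1_invariant_def)
  qed
qed (rule sub)

theorem theorem11p3:
  fixes p :: nat
  assumes "p \<ge> 2" and "CARD('n::finite) \<ge> 3"
  shows
    "(\<forall>G :: (complex^'n) set set.
        G \<noteq> {} \<and> G \<subseteq> Grass p \<and> grass_compact G \<and> SU_invariant G \<and>
        \<not> (p = 2 \<and> G = complex_lines)
        \<longrightarrow> transitivity_property G)
   \<and> (\<forall>G :: ((real^4)^'n) set set.
        G \<noteq> {} \<and> G \<subseteq> Grass p \<and> grass_compact G \<and> SpSp1_invariant G \<and>
        \<not> (p \<in> {2, 3, 4} \<and> G = in_quaternion_line p)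
        \<longrightarrow> transitivity_property G)
   \<and> (p \<ge> 5 \<longrightarrow>
      (\<forall>G :: ((real^4)^'n) set set.
        G \<noteq> {} \<and> G \<subseteq> Grass p \<and> grass_compact G \<and> Sp_invariant G
        \<longrightarrow> transitivity_property G))"
proof (intro conjI allI impI)
  fix G :: "(complex^'n) set set"
  assume "G \<noteq> {} \<and> G \<subseteq> Grass p \<and> grass_compact G \<and> SU_invariant G \<and>
    \<not> (p = 2 \<and> G = complex_lines)"
  then show "transitivity_property G" using transitivity_SU[OF assms] by blast
next
  fix G :: "((real^4)^'n) set set"
  assume G: "G \<noteq> {} \<and> G \<subseteq> Grass p \<and> grass_compact G \<and> SpSp1_invariant G \<and>
    \<not> (p \<in> {2, 3, 4} \<and> G = in_quaternion_line p)"
  show "transitivity_property G"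
  proof (rule ccontr)
    assume "\<not> transitivity_property G"
    then have sub: "G \<subseteq> in_quaternion_line p"
      using Sp_invariant_dichotomy[OF assms] G Sp_invariant_if_SpSp1_invariant by blast
    then have "p \<le> 4" using G dim_in_quaternion_line by blast
    then have "p \<in> {2, 3, 4}" using assms(1) by auto
    then show False using in_quaternion_line_single_orbit sub G by blast
  qed
next
  fix G :: "((real^4)^'n) set set"
  assume "p \<ge> 5"
    and G: "G \<noteq> {} \<and> G \<subseteq> Grass p \<and> grass_compact G \<and> Sp_invariant G"
  then have "\<not> G \<subseteq> in_quaternion_line p" using dim_in_quaternion_line by fastforce
  then show "transitivity_property G" using Sp_invariant_dichotomy[OF assms] G by blast
qed

end
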